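(* Let $n \ge 2$ be an integer, let $m_1,\dots,m_n$ and $\ell_1,\dots,\ell_n$ be positive real numbers with $m_i = m_{n+1-i}$ and $\ell_i = \ell_{n+1-i}$ for all $i \in \{1,\dots,\lfloor n/2\rfloor\}$, and let $d$ be a real number with $\max_i \ell_i < d < \sum_{i=1}^n \ell_i$. For $i \in \{1,\dots,n\}$ let $c_i = \frac12 m_i + \sum_{j=i+1}^n m_j$ (so $c_n = \frac12 m_n$), and let $\bar c = \frac12(m_1+\cdots+m_n)$. Then there exists a unique $\mu > 0$ such that the vector $y \in \mathbb{R}^n$ defined by $$y_i = -\frac{\ell_i (c_i - \bar c)}{\sqrt{(c_i-\bar c)^2 + \mu^2}},\qquad i \in \{1,\dots,n\},$$ is the unique optimal solution to $$(C)\qquad \min_{y\in\mathbb{R}^n}\left\{ \sum_{i=1}^n c_i y_i \ :\ \sum_{i=1}^n y_i = 0,\ d - \sum_{i=1}^n \sqrt{\ell_i^2-y_i^2} \le 0\right\}$$ and is symmetric.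
   Context: In problem $(C)$ the square roots are real, so feasible vectors $y$ are implicitly required to satisfy $|y_i|\le \ell_i$ for every $i$. An optimal solution is a feasible vector at which the minimum objective value over the feasible set is attained. A vector $y\in\mathbb{R}^n$ that is feasible for $(C)$ is called symmetric if $y_i = -y_{n+1-i}$ for all $i \in \{1,\dots,\lfloor n/2\rfloor\}$ and, when $n$ is odd, $y_{(n+1)/2} = 0$. *)

theory Defs
  imports "HOL-Analysis.Analysis" "HOL-Library.FuncSet"
begin

(* Data indexed by 1..n are functions on nat, read only on {1..n}.  A vector of R^n is an
   element of {1..n} \<rightarrow>\<^sub>E UNIV (undefined outside {1..n}), so that equality of functions is
   equality of vectors. *)

definition cost_coeff :: "nat \<Rightarrow> (nat \<Rightarrow> real) \<Rightarrow> nat \<Rightarrow> real" where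
  "cost_coeff n m i = 1/2 * m i + (\<Sum>j = i+1..n. m j)"

definition half_mass :: "nat \<Rightarrow> (nat \<Rightarrow> real) \<Rightarrow> real" where
  "half_mass n m = 1/2 * (\<Sum>i = 1..n. m i)"

definition objective :: "nat \<Rightarrow> (nat \<Rightarrow> real) \<Rightarrow> (nat \<Rightarrow> real) \<Rightarrow> real" where
  "objective n m y = (\<Sum>i = 1..n. cost_coeff n m i * y i)"

(* The bound on \<bar>y i\<bar> makes the square roots real; it must be explicit because the library's
   sqrt is total on the reals (sqrt (- x) = - sqrt x). *)
definition feasible_set :: "nat \<Rightarrow> (nat \<Rightarrow> real) \<Rightarrow> real \<Rightarrow> (nat \<Rightarrow> real) set" where
  "feasible_set n l d =
     {y \<in> {1..n} \<rightarrow>\<^sub>E UNIV.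
        (\<forall>i\<in>{1..n}. \<bar>y i\<bar> \<le> l i) \<and>
        (\<Sum>i = 1..n. y i) = 0 \<and>
        d - (\<Sum>i = 1..n. sqrt ((l i)\<^sup>2 - (y i)\<^sup>2)) \<le> 0}"

definition optimal_solution ::
    "nat \<Rightarrow> (nat \<Rightarrow> real) \<Rightarrow> (nat \<Rightarrow> real) \<Rightarrow> real \<Rightarrow> (nat \<Rightarrow> real) \<Rightarrow> bool" where
  "optimal_solution n m l d y \<longleftrightarrow>
     y \<in> feasible_set n l d \<and> (\<forall>z\<in>feasible_set n l d. objective n m y \<le> objective n m z)"

definition unique_optimal_solution ::
    "nat \<Rightarrow> (nat \<Rightarrow> real) \<Rightarrow> (nat \<Rightarrow> real) \<Rightarrow> real \<Rightarrow> (nat \<Rightarrow> real) \<Rightarrow> bool" where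
  "unique_optimal_solution n m l d y \<longleftrightarrow>
     optimal_solution n m l d y \<and> (\<forall>z. optimal_solution n m l d z \<longrightarrow> z = y)"

definition symmetric_solution :: "nat \<Rightarrow> (nat \<Rightarrow> real) \<Rightarrow> real \<Rightarrow> (nat \<Rightarrow> real) \<Rightarrow> bool" where
  "symmetric_solution n l d y \<longleftrightarrow>
     y \<in> feasible_set n l d \<and>
     (\<forall>i\<in>{1..n div 2}. y i = - y (n + 1 - i)) \<and>
     (odd n \<longrightarrow> y ((n + 1) div 2) = 0)"

definition candidate :: "nat \<Rightarrow> (nat \<Rightarrow> real) \<Rightarrow> (nat \<Rightarrow> real) \<Rightarrow> real \<Rightarrow> nat \<Rightarrow> real" where
  "candidate n m l \<mu> =
     (\<lambda>i\<in>{1..n}. - (l i * (cost_coeff n m i - half_mass n m) /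
                       sqrt ((cost_coeff n m i - half_mass n m)\<^sup>2 + \<mu>\<^sup>2)))"

end

theory Submission
  imports Defs
begin

text \<open>
  Put \<open>b\<^sub>i = c\<^sub>i - c\<close> with \<open>c = half_mass\<close>. On the hyperplane \<open>\<Sum> y\<^sub>i = 0\<close> the objective equals
  \<open>\<Sum> b\<^sub>i y\<^sub>i\<close>. For \<open>\<mu> > 0\<close> the Cauchy-Schwarz inequality gives
  \<open>b\<^sub>i z\<^sub>i - \<mu> \<surd>(l\<^sub>i\<^sup>2 - z\<^sub>i\<^sup>2) \<ge> - l\<^sub>i \<surd>(b\<^sub>i\<^sup>2 + \<mu>\<^sup>2)\<close> with equality only at the candidate, so summing over
  \<open>i\<close> the candidate is the unique optimum as soon as it sums to zero and makes the constraint
  tight. The first holds because the symmetry of \<open>m\<close> and \<open>l\<close> makes \<open>b\<close> antisymmetric; the second is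
  achieved for some \<open>\<mu>\<close> by the intermediate value theorem, as \<open>\<Sum> l\<^sub>i \<mu> / \<surd>(b\<^sub>i\<^sup>2 + \<mu>\<^sup>2)\<close> tends to
  \<open>\<Sum> l\<^sub>i\<close> at infinity, and at \<open>0\<close> to the sum of the \<open>l\<^sub>i\<close> with \<open>b\<^sub>i = 0\<close>, of which there is at most
  one. Finally \<open>\<mu>\<close> is determined by the first coordinate of the candidate since \<open>b\<^sub>1 \<noteq> 0\<close>.
\<close>

section \<open>One coordinate of the Lagrangian: lower bound and equality case\<close>

lemma lagrangian_term_ge:
  fixes b z l \<mu> :: real
  assumes "\<bar>z\<bar> \<le> l"
  shows "b * z - \<mu> * sqrt (l\<^sup>2 - z\<^sup>2) \<ge> - (l * sqrt (b\<^sup>2 + \<mu>\<^sup>2))"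
proof -
  have l: "0 \<le> l" and le: "z\<^sup>2 \<le> l\<^sup>2"
    using assms by (auto intro: abs_le_square_iff[THEN iffD1])
  define s where "s = sqrt (l\<^sup>2 - z\<^sup>2)"
  have s: "s\<^sup>2 = l\<^sup>2 - z\<^sup>2"
    using le by (simp add: s_def)
  \<comment> \<open>Lagrange's identity for \<open>(b, -\<mu>)\<close> and \<open>(z, s)\<close>,
    where \<open>(z, s)\<close> has length \<open>l\<close>; dropping the second square leaves
    Cauchy-Schwarz.\<close>
  have "(b * z - \<mu> * s)\<^sup>2 + (\<mu> * z + b * s)\<^sup>2 = (b\<^sup>2 + \<mu>\<^sup>2) * (z\<^sup>2 + s\<^sup>2)"
    by algebra
  also have "\<dots> = (l * sqrt (b\<^sup>2 + \<mu>\<^sup>2))\<^sup>2"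
    by (simp add: s power_mult_distrib)
  finally have "(b * z - \<mu> * s)\<^sup>2 \<le> (l * sqrt (b\<^sup>2 + \<mu>\<^sup>2))\<^sup>2"
    by (smt (verit) zero_le_power2)
  then have "\<bar>b * z - \<mu> * s\<bar> \<le> l * sqrt (b\<^sup>2 + \<mu>\<^sup>2)"
    using l by (simp only: abs_le_square_iff[symmetric] abs_mult abs_of_nonneg real_sqrt_ge_zero
        add_nonneg_nonneg zero_le_power2)
  then show ?thesis
    by (simp add: s_def)
qed

lemma lagrangian_term_eq:
  fixes b z l \<mu> :: real
  assumes "\<bar>z\<bar> \<le> l" and "\<mu> > 0"
    and eq: "b * z - \<mu> * sqrt (l\<^sup>2 - z\<^sup>2) = - (l * sqrt (b\<^sup>2 + \<mu>\<^sup>2))"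
  shows "z = - (l * b / sqrt (b\<^sup>2 + \<mu>\<^sup>2))"
proof -
  have le: "z\<^sup>2 \<le> l\<^sup>2"
    using assms by (auto intro: abs_le_square_iff[THEN iffD1])
  define s r where "s = sqrt (l\<^sup>2 - z\<^sup>2)" and "r = sqrt (b\<^sup>2 + \<mu>\<^sup>2)"
  have s: "s\<^sup>2 = l\<^sup>2 - z\<^sup>2" and r: "r\<^sup>2 = b\<^sup>2 + \<mu>\<^sup>2" and r0: "r > 0"
    using le \<open>\<mu> > 0\<close> by (auto simp: s_def r_def add_nonneg_pos)
  have eq': "b * z - \<mu> * s = - (l * r)"
    using eq by (simp add: s_def r_def)
  \<comment> \<open>Under \<open>eq'\<close> the first square already exhausts the right-hand side,
    so the determinant vanishes and \<open>(z, s)\<close> is parallel to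
    \<open>(b, -\<mu>)\<close>.\<close>
  have "(b * z - \<mu> * s)\<^sup>2 + (\<mu> * z + b * s)\<^sup>2 = (l * r)\<^sup>2"
    using s r by algebra
  then have "\<mu> * z + b * s = 0"
    by (simp add: eq')
  \<comment> \<open>Eliminating \<open>s\<close>:
    \<open>z * r\<^sup>2 = b * (b * z - \<mu> * s) = - b * l * r\<close>.\<close>
  then have "r * (z * r) = r * (- (l * b))"
    using eq' r by algebra
  then have "z * r = - (l * b)"
    using r0 by (metis less_irrefl mult_left_cancel)
  then show ?thesis
    unfolding r_def[symmetric] using r0 by (simp add: field_simps)
qed

text \<open>With \<open>r = sqrt (b\<^sup>2 + \<mu>\<^sup>2)\<close>, the point
  \<open>(- l * b / r, l * \<mu> / r)\<close> lies on the upper half of the circle of radius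
  \<open>l\<close>.\<close>

lemma sqrt_candidate_term:
  fixes b l \<mu> :: real
  assumes "l > 0" and "\<mu> > 0"
  shows "sqrt (l\<^sup>2 - (- (l * b / sqrt (b\<^sup>2 + \<mu>\<^sup>2)))\<^sup>2) = l * \<mu> / sqrt (b\<^sup>2 + \<mu>\<^sup>2)"
proof -
  define r where "r = sqrt (b\<^sup>2 + \<mu>\<^sup>2)"
  have r: "r\<^sup>2 = b\<^sup>2 + \<mu>\<^sup>2" and r0: "r > 0"
    using assms by (auto simp: r_def add_nonneg_pos)
  have "l\<^sup>2 - (- (l * b / r))\<^sup>2 = l\<^sup>2 * (r\<^sup>2 - b\<^sup>2) / r\<^sup>2"
    using r0 by (simp add: power_divide power_mult_distrib diff_divide_distrib right_diff_distrib)
  also have "\<dots> = (l * \<mu> / r)\<^sup>2"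
    by (simp add: r power_divide power_mult_distrib)
  finally show ?thesis
    using assms r0 by (simp add: r_def[symmetric])
qed

lemma abs_candidate_term_le:
  fixes b l \<mu> :: real
  assumes "l > 0" and "\<mu> > 0"
  shows "\<bar>- (l * b / sqrt (b\<^sup>2 + \<mu>\<^sup>2))\<bar> \<le> l"
proof -
  have "\<bar>b\<bar> \<le> sqrt (b\<^sup>2 + \<mu>\<^sup>2)"
    by (simp add: real_le_rsqrt)
  moreover have "sqrt (b\<^sup>2 + \<mu>\<^sup>2) > 0"
    using assms by (simp add: add_nonneg_pos)
  ultimately show ?thesis
    using assms by (simp add: abs_mult divide_le_eq mult_left_mono)
qed

text \<open>The candidate attains the bound of \<open>lagrangian_term_ge\<close>; its square root is
  already replaced by the value from \<open>sqrt_candidate_term\<close>.\<close>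

lemma lagrangian_candidate_term:
  fixes b l \<mu> :: real
  assumes "l > 0" and "\<mu> > 0"
  shows "b * (- (l * b / sqrt (b\<^sup>2 + \<mu>\<^sup>2))) - \<mu> * (l * \<mu> / sqrt (b\<^sup>2 + \<mu>\<^sup>2))
           = - (l * sqrt (b\<^sup>2 + \<mu>\<^sup>2))"
proof -
  define r where "r = sqrt (b\<^sup>2 + \<mu>\<^sup>2)"
  have r: "r\<^sup>2 = b\<^sup>2 + \<mu>\<^sup>2" and r0: "r > 0"
    using assms by (auto simp: r_def add_nonneg_pos)
  have "b * (- (l * b / r)) - \<mu> * (l * \<mu> / r) = - (l * r\<^sup>2) / r"
    unfolding r using r0 by (simp add: field_simps power2_eq_square)
  also have "\<dots> = - (l * r)"
    using r0 by (simp add: power2_eq_square)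
  finally show ?thesis
    by (simp add: r_def)
qed

section \<open>Optimality of the candidate for a given multiplier\<close>

lemma objective_eq_centered:
  assumes "y \<in> feasible_set n l d"
  shows "objective n m y = (\<Sum>i = 1..n. (cost_coeff n m i - half_mass n m) * y i)"
proof -
  have "(\<Sum>i = 1..n. half_mass n m * y i) = 0"
    using assms by (simp add: feasible_set_def flip: sum_distrib_left)
  then show ?thesis
    by (simp add: objective_def left_diff_distrib sum_subtractf)
qed

text \<open>Lagrangian duality with multiplier \<open>\<mu>\<close>: \<open>zero\<close> and
  \<open>tight\<close> supply feasibility and complementary slackness.\<close>

lemma candidate_unique_optimal:
  fixes l m :: "nat \<Rightarrow> real"
  assumes l: "\<And>i. i \<in> {1..n} \<Longrightarrow> l i > 0" and \<mu>: "\<mu> > 0"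
    and zero: "(\<Sum>i = 1..n. candidate n m l \<mu> i) = 0"
    and tight: "(\<Sum>i = 1..n. l i * \<mu> / sqrt ((cost_coeff n m i - half_mass n m)\<^sup>2 + \<mu>\<^sup>2)) = d"
  shows "unique_optimal_solution n m l d (candidate n m l \<mu>)"
proof -
  define b where "b i = cost_coeff n m i - half_mass n m" for i
  define y where "y = candidate n m l \<mu>"
  \<comment> \<open>The Lagrangian, up to the constant \<open>\<mu> * d\<close>, is the sum of these
    terms, so it can be minimized coordinate by coordinate.\<close>
  define L where "L z i = b i * z i - \<mu> * sqrt ((l i)\<^sup>2 - (z i)\<^sup>2)" for z :: "nat \<Rightarrow> real" and i
  have y: "y i = - (l i * b i / sqrt ((b i)\<^sup>2 + \<mu>\<^sup>2))" if "i \<in> {1..n}" for i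
    using that by (simp add: y_def candidate_def b_def)
  have sq: "sqrt ((l i)\<^sup>2 - (y i)\<^sup>2) = l i * \<mu> / sqrt ((b i)\<^sup>2 + \<mu>\<^sup>2)" if "i \<in> {1..n}" for i
    unfolding y[OF that] using l[OF that] \<mu> by (rule sqrt_candidate_term)
  have sum_sq: "(\<Sum>i = 1..n. sqrt ((l i)\<^sup>2 - (y i)\<^sup>2)) = d"
    using tight sq by (simp add: b_def)
  have bd: "\<bar>y i\<bar> \<le> l i" if "i \<in> {1..n}" for i
    unfolding y[OF that] using l[OF that] \<mu> by (rule abs_candidate_term_le)
  have "y \<in> {1..n} \<rightarrow>\<^sub>E UNIV"
    by (simp add: y_def candidate_def)
  then have feas: "y \<in> feasible_set n l d"
    using bd zero sum_sq by (simp add: feasible_set_def y_def)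
  have Ly: "L y i = - (l i * sqrt ((b i)\<^sup>2 + \<mu>\<^sup>2))" if "i \<in> {1..n}" for i
    unfolding L_def sq[OF that] unfolding y[OF that]
    using l[OF that] \<mu> by (rule lagrangian_candidate_term)
  have obj: "objective n m z = (\<Sum>i = 1..n. L z i) + \<mu> * (\<Sum>i = 1..n. sqrt ((l i)\<^sup>2 - (z i)\<^sup>2))"
    if "z \<in> feasible_set n l d" for z
    using that by (simp add: objective_eq_centered L_def b_def sum_subtractf sum_distrib_left)
  have Lz: "L y i \<le> L z i" if "z \<in> feasible_set n l d" "i \<in> {1..n}" for z i
  proof -
    have "\<bar>z i\<bar> \<le> l i"
      using that by (simp add: feasible_set_def)
    then show ?thesis
      unfolding Ly[OF that(2)] unfolding L_def by (rule lagrangian_term_ge)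
  qed
  \<comment> \<open>The square roots sum to exactly \<open>d\<close> at \<open>y\<close> and to at
    least \<open>d\<close> at \<open>z\<close>. The difference of Lagrangians is kept explicit: its
    sign gives optimality, its vanishing gives uniqueness.\<close>
  have gap: "objective n m y + ((\<Sum>i = 1..n. L z i) - (\<Sum>i = 1..n. L y i)) \<le> objective n m z"
    if "z \<in> feasible_set n l d" for z
  proof -
    have "\<mu> * d \<le> \<mu> * (\<Sum>i = 1..n. sqrt ((l i)\<^sup>2 - (z i)\<^sup>2))"
      using that \<mu> by (intro mult_left_mono) (auto simp: feasible_set_def)
    then show ?thesis
      unfolding obj[OF that] obj[OF feas] sum_sq by linarith
  qed
  have sum_le: "(\<Sum>i = 1..n. L y i) \<le> (\<Sum>i = 1..n. L z i)" if "z \<in> feasible_set n l d" for z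
    by (rule sum_mono) (rule Lz[OF that])
  have opt: "optimal_solution n m l d y"
    unfolding optimal_solution_def using feas gap sum_le by fastforce
  have "z = y" if z: "optimal_solution n m l d z" for z
  proof -
    have zf: "z \<in> feasible_set n l d" and "objective n m z \<le> objective n m y"
      using z feas by (auto simp: optimal_solution_def)
    \<comment> \<open>A second optimum leaves no gap, so each termwise inequality \<open>Lz\<close>
      is an equality and \<open>lagrangian_term_eq\<close> fixes every coordinate.\<close>
    then have sum_eq: "(\<Sum>i = 1..n. L y i) = (\<Sum>i = 1..n. L z i)"
      using gap[OF zf] sum_le[OF zf] by simp
    have eq: "L y i = L z i" if "i \<in> {1..n}" for i
      using sum_mono_inv[OF sum_eq Lz[OF zf] that] by simp
    show ?thesis
    proof (rule PiE_ext)
      show "z \<in> {1..n} \<rightarrow>\<^sub>E UNIV" and "y \<in> {1..n} \<rightarrow>\<^sub>E UNIV"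
        using zf feas by (simp_all add: feasible_set_def)
      fix i assume i: "i \<in> {1..n}"
      have "\<bar>z i\<bar> \<le> l i"
        using zf i by (simp add: feasible_set_def)
      moreover have "b i * z i - \<mu> * sqrt ((l i)\<^sup>2 - (z i)\<^sup>2) = - (l i * sqrt ((b i)\<^sup>2 + \<mu>\<^sup>2))"
        using eq[OF i] Ly[OF i] unfolding L_def by (rule trans[OF sym])
      ultimately show "z i = y i"
        unfolding y[OF i] by (rule lagrangian_term_eq[OF _ \<mu>])
    qed
  qed
  with opt show ?thesis
    unfolding unique_optimal_solution_def y_def by blast
qed

section \<open>Consequences of the reflection symmetry of the data\<close>

lemma reflection_eq:
  fixes f :: "nat \<Rightarrow> real"
  assumes "\<And>i. i \<in> {1..n div 2} \<Longrightarrow> f i = f (n + 1 - i)" and i: "i \<in> {1..n}"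
  shows "f (n + 1 - i) = f i"
proof -
  \<comment> \<open>The hypothesis covers the lower half only; the upper half reflects into it, and
    for odd \<open>n\<close> the middle index is fixed.\<close>
  consider "i \<in> {1..n div 2}" | "n + 1 - i \<in> {1..n div 2}" | "n + 1 - i = i"
    using i by (simp; linarith)
  then show ?thesis
  proof cases
    case 2
    then show ?thesis
      using assms(1)[OF 2] i by simp
  qed (use assms(1) in auto)
qed

text \<open>The centered coefficient is half of the mass after \<open>i\<close> minus the mass
  before \<open>i\<close>, and reflection swaps these two masses.\<close>

lemma cost_coeff_reflection:
  fixes m :: "nat \<Rightarrow> real"
  assumes sym: "\<And>i. i \<in> {1..n} \<Longrightarrow> m (n + 1 - i) = m i" and i: "i \<in> {1..n}"
  shows "cost_coeff n m (n + 1 - i) - half_mass n m = - (cost_coeff n m i - half_mass n m)"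
proof -
  have "(\<Sum>j = n + 1 - i + 1..n. m j) = (\<Sum>j = 1..i - 1. m j)"
    using i by (intro sum.reindex_bij_witness[of _ "\<lambda>j. n + 1 - j" "\<lambda>j. n + 1 - j"])
      (use i sym in \<open>fastforce+\<close>)
  moreover have "(\<Sum>j = 1..n. m j) = (\<Sum>j = 1..i - 1. m j) + (\<Sum>j = i..n. m j)"
    using i by (subst sum.union_disjoint[symmetric]) (auto intro!: sum.cong)
  moreover have "(\<Sum>j = i..n. m j) = m i + (\<Sum>j = i + 1..n. m j)"
    using i by (simp add: sum.atLeast_Suc_atMost)
  ultimately show ?thesis
    using sym[OF i] unfolding cost_coeff_def half_mass_def by linarith
qed

text \<open>The tail after \<open>i\<close> contains \<open>m j\<close> and the tail after
  \<open>j\<close>, so the drop is at least \<open>(m i + m j) / 2\<close>.\<close>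

lemma cost_coeff_strict_antimono:
  fixes m :: "nat \<Rightarrow> real"
  assumes pos: "\<And>i. i \<in> {1..n} \<Longrightarrow> m i > 0" and "1 \<le> i" "i < j" "j \<le> n"
  shows "cost_coeff n m j < cost_coeff n m i"
proof -
  have "(\<Sum>k = j..n. m k) \<le> (\<Sum>k = i + 1..n. m k)"
    using assms by (intro sum_mono2) (auto simp: less_imp_le)
  moreover have "(\<Sum>k = j..n. m k) = m j + (\<Sum>k = j + 1..n. m k)"
    using assms by (simp add: sum.atLeast_Suc_atMost)
  moreover have "m i > 0" "m j > 0"
    using assms by auto
  ultimately show ?thesis
    by (simp add: cost_coeff_def)
qed

lemma sum_antisymmetric_eq_0:
  fixes f :: "nat \<Rightarrow> real"
  assumes "\<And>i. i \<in> {1..n} \<Longrightarrow> f (n + 1 - i) = - f i"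
  shows "(\<Sum>i = 1..n. f i) = 0"
proof -
  have "(\<Sum>i = 1..n. f i) = (\<Sum>i = 1..n. f (n + 1 - i))"
    by (rule sum.atLeastAtMost_rev)
  also have "\<dots> = (\<Sum>i = 1..n. - f i)"
    by (rule sum.cong[OF refl assms])
  finally show ?thesis
    by (simp add: sum_negf)
qed

section \<open>Existence of a multiplier that makes the constraint tight\<close>

lemma exists_tight_multiplier:
  fixes b l :: "'a \<Rightarrow> real"
  assumes "(\<Sum>i\<in>A. if b i = 0 then l i else 0) < d" and "d < (\<Sum>i\<in>A. l i)"
  shows "\<exists>\<mu>>0. (\<Sum>i\<in>A. l i * \<mu> / sqrt ((b i)\<^sup>2 + \<mu>\<^sup>2)) = d"
proof -
  define F where "F \<mu> = (\<Sum>i\<in>A. l i * \<mu> / sqrt ((b i)\<^sup>2 + \<mu>\<^sup>2))" for \<mu> :: real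
  have "((\<lambda>\<mu>. l i * \<mu> / sqrt ((b i)\<^sup>2 + \<mu>\<^sup>2)) \<longlongrightarrow> (if b i = 0 then l i else 0)) (at_right 0)" for i
  proof (cases "b i = 0")
    case True
    \<comment> \<open>For \<open>b i = 0\<close> the term is constantly \<open>l i\<close> on
      \<open>\<mu> > 0\<close>, while at \<open>\<mu> = 0\<close> division by zero makes it 0; hence
      a right limit instead of the value at 0.\<close>
    have "eventually (\<lambda>\<mu>. l i = l i * \<mu> / sqrt ((b i)\<^sup>2 + \<mu>\<^sup>2)) (at_right (0::real))"
      using eventually_at_right_less by eventually_elim (simp add: True)
    from tendsto_cong[THEN iffD1, OF this tendsto_const] show ?thesis
      by (simp add: True)
  next
    case False
    then have "((\<lambda>\<mu>. l i * \<mu> / sqrt ((b i)\<^sup>2 + \<mu>\<^sup>2)) \<longlongrightarrow> l i * 0 / sqrt ((b i)\<^sup>2 + 0\<^sup>2)) (at_right 0)"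
      by (intro tendsto_intros) auto
    with False show ?thesis
      by simp
  qed
  then have "(F \<longlongrightarrow> (\<Sum>i\<in>A. if b i = 0 then l i else 0)) (at_right 0)"
    unfolding F_def by (rule tendsto_sum)
  then have "eventually (\<lambda>\<mu>. F \<mu> < d) (at_right 0)"
    using assms(1) by (rule order_tendstoD)
  then obtain \<epsilon> where \<epsilon>: "\<epsilon> > 0" "\<And>\<mu>. 0 < \<mu> \<Longrightarrow> \<mu> < \<epsilon> \<Longrightarrow> F \<mu> < d"
    unfolding eventually_at_right_field by blast
  have "((\<lambda>\<mu>. l i * \<mu> / sqrt ((b i)\<^sup>2 + \<mu>\<^sup>2)) \<longlongrightarrow> l i) at_top" for i
  proof -
    \<comment> \<open>Dividing numerator and denominator by \<open>\<mu>\<close> leaves a function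
      of \<open>b i / \<mu>\<close>.\<close>
    have "((\<lambda>\<mu>::real. b i / \<mu>) \<longlongrightarrow> 0) at_top"
      by (rule tendsto_divide_0[OF tendsto_const]) (rule filterlim_at_top_imp_at_infinity, rule filterlim_ident)
    then have "((\<lambda>\<mu>::real. l i / sqrt ((b i / \<mu>)\<^sup>2 + 1)) \<longlongrightarrow> l i / sqrt (0\<^sup>2 + 1)) at_top"
      by (intro tendsto_intros) auto
    moreover have "eventually (\<lambda>\<mu>. l i / sqrt ((b i / \<mu>)\<^sup>2 + 1) = l i * \<mu> / sqrt ((b i)\<^sup>2 + \<mu>\<^sup>2)) at_top"
      using eventually_gt_at_top[of "0::real"]
    proof eventually_elim
      case (elim \<mu>)
      then have "(b i / \<mu>)\<^sup>2 + 1 = ((b i)\<^sup>2 + \<mu>\<^sup>2) / \<mu>\<^sup>2"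
        by (simp add: field_simps)
      with elim show ?case
        by (simp add: real_sqrt_divide)
    qed
    ultimately show ?thesis
      using tendsto_cong by force
  qed
  then have "(F \<longlongrightarrow> (\<Sum>i\<in>A. l i)) at_top"
    unfolding F_def by (rule tendsto_sum)
  then have "eventually (\<lambda>\<mu>. d < F \<mu>) at_top"
    using assms(2) by (rule order_tendstoD)
  then obtain M where M: "\<And>\<mu>. \<mu> \<ge> M \<Longrightarrow> d < F \<mu>"
    unfolding eventually_at_top_linorder by blast
  \<comment> \<open>The left end \<open>\<epsilon> / 2\<close> lies strictly inside the range where
    \<open>F < d\<close> and keeps \<open>\<mu>\<close> positive; the maximum orders the
    endpoints.\<close>
  have "continuous_on {\<epsilon> / 2..max \<epsilon> M} F"
    unfolding F_def
  proof (intro continuous_intros ballI)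
    fix i and \<mu> :: real
    assume "\<mu> \<in> {\<epsilon> / 2..max \<epsilon> M}"
    then have "\<mu> > 0"
      using \<epsilon>(1) by auto
    then show "sqrt ((b i)\<^sup>2 + \<mu>\<^sup>2) \<noteq> 0"
      by (simp add: add_nonneg_eq_0_iff)
  qed
  moreover have "F (\<epsilon> / 2) \<le> d" "d \<le> F (max \<epsilon> M)" "\<epsilon> / 2 \<le> max \<epsilon> M"
    using \<epsilon>(1) \<epsilon>(2)[of "\<epsilon> / 2"] M[of "max \<epsilon> M"] by auto
  ultimately obtain \<mu> where "\<epsilon> / 2 \<le> \<mu>" "F \<mu> = d"
    using IVT'[of F "\<epsilon> / 2" d "max \<epsilon> M"] by blast
  with \<epsilon>(1) show ?thesis
    unfolding F_def by (intro exI[of _ \<mu>]) auto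
qed

section \<open>Existence and uniqueness of the multiplier for symmetric data\<close>

theorem theorem7:
  fixes n :: nat and m l :: "nat \<Rightarrow> real" and d :: real
  assumes "n \<ge> 2"
    and "\<And>i. i \<in> {1..n} \<Longrightarrow> m i > 0"
    and "\<And>i. i \<in> {1..n} \<Longrightarrow> l i > 0"
    and "\<And>i. i \<in> {1..n div 2} \<Longrightarrow> m i = m (n + 1 - i)"
    and "\<And>i. i \<in> {1..n div 2} \<Longrightarrow> l i = l (n + 1 - i)"
    and "Max (l ` {1..n}) < d"
    and "d < (\<Sum>i = 1..n. l i)"
  shows "\<exists>!\<mu>::real. \<mu> > 0 \<and>
           unique_optimal_solution n m l d (candidate n m l \<mu>) \<and>
           symmetric_solution n l d (candidate n m l \<mu>)"
proof -
  define b where "b i = cost_coeff n m i - half_mass n m" for i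
  have cand: "candidate n m l \<mu> i = - (l i * b i / sqrt ((b i)\<^sup>2 + \<mu>\<^sup>2))"
    if "i \<in> {1..n}" for i \<mu>
    using that by (simp add: candidate_def b_def)
  have l_sym: "l (n + 1 - i) = l i" if "i \<in> {1..n}" for i
    using assms(5) that by (rule reflection_eq)
  have m_sym: "m (n + 1 - i) = m i" if "i \<in> {1..n}" for i
    using assms(4) that by (rule reflection_eq)
  have b_anti: "b (n + 1 - i) = - b i" if "i \<in> {1..n}" for i
    unfolding b_def using m_sym that by (rule cost_coeff_reflection)
  \<comment> \<open>Only a central index can be a zero of \<open>b\<close>: antisymmetry makes the
    reflected index a zero too, and strict monotonicity separates distinct indices.\<close>
  have b_0: "n + 1 - i = i" if "i \<in> {1..n}" "b i = 0" for i
  proof (rule ccontr)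
    assume "n + 1 - i \<noteq> i"
    then consider "i < n + 1 - i" | "n + 1 - i < i"
      by linarith
    then have "b (n + 1 - i) \<noteq> b i"
      using cost_coeff_strict_antimono[of n m i "n + 1 - i"]
        cost_coeff_strict_antimono[of n m "n + 1 - i" i] assms(2) that(1)
      by cases (fastforce simp: b_def)+
    then show False
      using b_anti[OF that(1)] that(2) by simp
  qed
  have b_1: "b 1 \<noteq> 0"
    using b_0[of 1] \<open>n \<ge> 2\<close> by auto
  have cand_anti: "candidate n m l \<mu> (n + 1 - i) = - candidate n m l \<mu> i"
    if "i \<in> {1..n}" for i \<mu>
  proof -
    have "n + 1 - i \<in> {1..n}"
      using that by auto
    then show ?thesis
      by (simp add: cand[OF that] cand[OF \<open>n + 1 - i \<in> {1..n}\<close>] b_anti[OF that] l_sym[OF that]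
          del: One_nat_def)
  qed
  have "(\<Sum>i = 1..n. if b i = 0 then l i else 0) \<le> Max (l ` {1..n})"
  proof (cases "\<exists>k\<in>{1..n}. b k = 0")
    case True
    then obtain k where k: "k \<in> {1..n}" "b k = 0"
      by blast
    have "(if b i = 0 then l i else 0) = (if i = k then l k else 0)" if "i \<in> {1..n}" for i
    proof -
      have "b i = 0 \<longleftrightarrow> i = k"
      proof
        \<comment> \<open>Both zeros are fixed by the reflection:
          \<open>2 * i = n + 1 = 2 * k\<close>.\<close>
        show "i = k" if "b i = 0"
          using b_0[OF \<open>i \<in> {1..n}\<close> that] b_0[OF k] by linarith
      qed (simp add: k(2))
      then show ?thesis
        by simp
    qed
    then have "(\<Sum>i = 1..n. if b i = 0 then l i else 0) = l k"
      using k(1) by simp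
    also have "\<dots> \<le> Max (l ` {1..n})"
      using k(1) by (intro Max_ge) auto
    finally show ?thesis .
  next
    case False
    then have "(\<Sum>i = 1..n. if b i = 0 then l i else 0) = 0"
      by (intro sum.neutral) auto
    also have "\<dots> \<le> l 1"
      using assms(1,3) by (simp add: less_imp_le)
    also have "\<dots> \<le> Max (l ` {1..n})"
      using \<open>n \<ge> 2\<close> by (intro Max_ge) auto
    finally show ?thesis .
  qed
  then obtain \<mu> where \<mu>: "\<mu> > 0" "(\<Sum>i = 1..n. l i * \<mu> / sqrt ((b i)\<^sup>2 + \<mu>\<^sup>2)) = d"
    using exists_tight_multiplier[of b l "{1..n}" d] assms(6,7) by fastforce
  have opt: "unique_optimal_solution n m l d (candidate n m l \<mu>)"
    using assms(3) \<mu>(1) sum_antisymmetric_eq_0[where f = "candidate n m l \<mu>", OF cand_anti] \<mu>(2)[unfolded b_def]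
    by (rule candidate_unique_optimal)
  show ?thesis
  proof (intro ex1I conjI)
    show "symmetric_solution n l d (candidate n m l \<mu>)"
      unfolding symmetric_solution_def
    proof (intro conjI ballI impI)
      show "candidate n m l \<mu> \<in> feasible_set n l d"
        using opt by (simp add: unique_optimal_solution_def optimal_solution_def)
      show "candidate n m l \<mu> i = - candidate n m l \<mu> (n + 1 - i)" if "i \<in> {1..n div 2}" for i
      proof -
        have "i \<in> {1..n}"
          using that by auto
        then show ?thesis
          using cand_anti by fastforce
      qed
      show "candidate n m l \<mu> ((n + 1) div 2) = 0" if "odd n"
      proof -
        have "(n + 1) div 2 \<in> {1..n}" "n + 1 - (n + 1) div 2 = (n + 1) div 2"
          using that by (auto elim!: oddE)
        then show ?thesis
          using cand_anti[of "(n + 1) div 2" \<mu>] by simp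
      qed
    qed
  next
    fix \<nu> :: real
    assume \<nu>: "\<nu> > 0 \<and> unique_optimal_solution n m l d (candidate n m l \<nu>) \<and>
      symmetric_solution n l d (candidate n m l \<nu>)"
    then have "candidate n m l \<nu> = candidate n m l \<mu>"
      using opt by (simp add: unique_optimal_solution_def)
    then have "candidate n m l \<nu> 1 = candidate n m l \<mu> 1"
      by simp
    moreover have "l 1 \<noteq> 0"
      using assms(1) assms(3)[of 1] by force
    \<comment> \<open>The two fractions share the nonzero numerator \<open>l 1 * b 1\<close>, so
      their denominators agree; positivity then gives \<open>\<nu> = \<mu>\<close>.\<close>
    ultimately have "sqrt ((b 1)\<^sup>2 + \<nu>\<^sup>2) = sqrt ((b 1)\<^sup>2 + \<mu>\<^sup>2)"
      using \<open>n \<ge> 2\<close> b_1 by (simp add: cand del: real_sqrt_eq_iff)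
    then show "\<nu> = \<mu>"
      using \<nu> \<mu>(1) by simp
  qed (use \<mu>(1) opt in auto)
qed

end
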